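(* Let $\{E_\phi\}_\phi$ be an ensemble of operators on $\mathcal H$ (with a probability distribution over $\phi$) such that $\mathcal E(\rho)=\mathbb E_\phi\{E_\phi\,\rho\,E_\phi^\dagger\}$ is a quantum channel. Denote by $T_\phi$ the locality transfer matrix associated to $\mathcal E_\phi^\dagger(\cdot)=E_\phi^\dagger\cdot E_\phi$, and by $T$ the locality transfer matrix of $\mathcal E^\dagger$. Then $$\mathbb E_\phi\{T_\phi\}\ \ge\ T$$ elementwise, with equality if and only if $\mathcal E$ is unitary.
   Context: Let $\mathcal H=\bigotimes_{m=1}^M\mathcal H_m$ be the Hilbert space of $n$ qubits, where each $\mathcal H_m$ (of dimension $d_m$) is a single qubit or a group of qubits. Let $\mathcal B$ be the space of linear operators on $\mathcal H$. For $\kappa\in\{0,1\}^M$ let $\mathcal B_\kappa\subset\mathcal B$ be the span of the operators $\bigotimes_m A_m$ with $A_m=\mathbb 1$ if $\kappa_m=0$ and $\mathrm{Tr}[A_m]=0$ if $\kappa_m=1$. Then $\mathcal B=\bigoplus_\kappa\mathcal B_\kappa$ and $d_\kappa:=\dim\mathcal B_\kappa=\prod_m(d_m^2-1)^{\kappa_m}$. For $A\in\mathcal B$ the locality vector $\ell_A$, indexed by $\{0,1\}^M$, is $(\ell_A)_\kappa=\sum_{j=1}^{d_\kappa}\mathrm{Tr}[B_jA]^2$, for any basis $\{B_j\}$ of $\mathcal B_\kappa$ consisting of Hermitian operators and orthonormal for the Hilbert–Schmidt product (the value does not depend on the basis). The locality transfer matrix of a linear map $\Lambda:\mathcal B\to\mathcal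 B$ is $T_{\kappa,\lambda}=\frac1{d_\lambda}\sum_{j=1}^{d_\lambda}(\ell_{\Lambda(B_j)})_\kappa$, with $\{B_j\}$ a Hermitian orthonormal basis of $\mathcal B_\lambda$. A quantum channel is a completely positive, trace preserving linear map $\mathcal B\to\mathcal B$; it is unitary if it has the form $\rho\mapsto W\rho W^\dagger$ with $W$ unitary. $\mathcal E^\dagger$ is the Hilbert–Schmidt adjoint of $\mathcal E$.
   Formalization: Equality is shown to hold iff the channel is unitary and Tr[E_φ†E_φ] = dim H for almost every φ; without this normalisation "unitary implies equality" fails, e.g. E_φ = c_φ W with W unitary and |c_φ|² = 1/2 or 3/2, each with probability 1/2. *)

theory Defs
  imports "HOL-Analysis.Analysis" "HOL-Probability.Probability"
begin

text \<open>The \<open>n\<close> qubits are the elements of a finite type \<open>'n\<close> and the factors \<open>H\<^sub>1, \<dots>, H\<^sub>M\<close> the elements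
  of a finite type \<open>'m\<close>; a surjection \<open>g :: 'n \<Rightarrow> 'm\<close> assigns to each qubit the factor it belongs
  to.  The computational basis of \<open>H\<close> is the set of all bit assignments \<open>'n \<Rightarrow> bool\<close>, that of
  \<open>H\<^sub>m\<close> the set of bit assignments to the qubits \<open>g -` {m}\<close>, extended by \<open>undefined\<close>.\<close>

type_synonym 'n qop = "complex ^ ('n \<Rightarrow> bool) ^ ('n \<Rightarrow> bool)"

definition dagger :: "complex^'k^'k \<Rightarrow> complex^'k^'k" where
  "dagger A = (\<chi> i j. cnj (A $ j $ i))"

definition hs_inner :: "complex^'k^'k \<Rightarrow> complex^'k^'k \<Rightarrow> complex" where
  "hs_inner A B = trace (dagger A ** B)"

definition cscale :: "complex \<Rightarrow> complex^'k^'k \<Rightarrow> complex^'k^'k" where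
  "cscale c A = (\<chi> i j. c * A $ i $ j)"

interpretation qop: vector_space cscale
  by unfold_locales (simp_all add: cscale_def vec_eq_iff algebra_simps)


subsection \<open>Locality vectors and transfer matrices\<close>

text \<open>A family \<open>A m\<close> of operators on the factors \<open>H\<^sub>m\<close>: only the values \<open>A m x y\<close> for \<open>x\<close>, \<open>y\<close> in
  the basis of \<open>H\<^sub>m\<close> matter.\<close>

definition tensor_op ::
  "('n::finite \<Rightarrow> 'm::finite) \<Rightarrow> ('m \<Rightarrow> ('n \<Rightarrow> bool) \<Rightarrow> ('n \<Rightarrow> bool) \<Rightarrow> complex) \<Rightarrow> 'n qop" where
  "tensor_op g A =
    (\<chi> x y. \<Prod>m\<in>UNIV. A m (restrict x (g -` {m})) (restrict y (g -` {m})))"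

definition local_id :: "('n \<Rightarrow> bool) \<Rightarrow> ('n \<Rightarrow> bool) \<Rightarrow> complex" where
  "local_id x y = (if x = y then 1 else 0)"

definition local_trace :: "'n set \<Rightarrow> (('n \<Rightarrow> bool) \<Rightarrow> ('n \<Rightarrow> bool) \<Rightarrow> complex) \<Rightarrow> complex" where
  "local_trace S a = (\<Sum>x \<in> PiE S (\<lambda>_. UNIV). a x x)"

definition locality_space ::
  "('n::finite \<Rightarrow> 'm::finite) \<Rightarrow> ('m \<Rightarrow> bool) \<Rightarrow> 'n qop set" where
  "locality_space g \<kappa> = qop.span {tensor_op g A | A.
     \<forall>m. if \<kappa> m then local_trace (g -` {m}) (A m) = 0 else A m = local_id}"

definition hermitian_onb :: "(complex^'k^'k) set \<Rightarrow> (complex^'k^'k) set \<Rightarrow> bool" where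
  "hermitian_onb V \<B> \<longleftrightarrow> qop.span \<B> = V \<and> (\<forall>B\<in>\<B>. dagger B = B) \<and>
     (\<forall>B\<in>\<B>. \<forall>C\<in>\<B>. hs_inner B C = (if B = C then 1 else 0))"

text \<open>A choice of basis of the \<open>\<kappa>\<close>-space.  Such bases exist (\<open>locality_basis_onb\<close>), and the choice is
  irrelevant below (\<open>locality_vector_basis_indep\<close>, \<open>transfer_matrix_basis_indep\<close>).\<close>

definition locality_basis :: "('n::finite \<Rightarrow> 'm::finite) \<Rightarrow> ('m \<Rightarrow> bool) \<Rightarrow> 'n qop set" where
  "locality_basis g \<kappa> = (SOME \<B>. hermitian_onb (locality_space g \<kappa>) \<B>)"

text \<open>The squares are squares of complex numbers; they are real when \<open>A\<close> is Hermitian.\<close>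

definition locality_vector ::
  "('n::finite \<Rightarrow> 'm::finite) \<Rightarrow> 'n qop \<Rightarrow> ('m \<Rightarrow> bool) \<Rightarrow> complex" where
  "locality_vector g A \<kappa> = (\<Sum>B \<in> locality_basis g \<kappa>. (trace (B ** A))\<^sup>2)"

text \<open>Real for Hermiticity-preserving maps (\<open>transfer_matrix_real\<close>).\<close>

definition transfer_matrix ::
  "('n::finite \<Rightarrow> 'm::finite) \<Rightarrow> ('n qop \<Rightarrow> 'n qop) \<Rightarrow> ('m \<Rightarrow> bool) \<Rightarrow> ('m \<Rightarrow> bool) \<Rightarrow> complex" where
  "transfer_matrix g \<Lambda> \<kappa> \<mu> =
    (1 / of_nat (qop.dim (locality_space g \<mu>))) *
      (\<Sum>B \<in> locality_basis g \<mu>. locality_vector g (\<Lambda> B) \<kappa>)"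


subsection \<open>Quantum channels\<close>

text \<open>A \<open>k \<times> k\<close> block matrix of operators, i.e. an operator on \<open>\<complex>\<^sup>k \<otimes> H\<close>, is positive semidefinite.\<close>

definition block_positive :: "nat \<Rightarrow> (nat \<Rightarrow> nat \<Rightarrow> complex^'k^'k) \<Rightarrow> bool" where
  "block_positive k A \<longleftrightarrow> (\<forall>v :: nat \<Rightarrow> complex^'k.
     (\<Sum>a<k. \<Sum>b<k. \<Sum>x\<in>UNIV. cnj (v a $ x) * (A a b *v v b) $ x) \<in> \<real>\<^sub>\<ge>\<^sub>0)"

definition completely_positive :: "(complex^'k^'k \<Rightarrow> complex^'k^'k) \<Rightarrow> bool" where
  "completely_positive \<Lambda> \<longleftrightarrow>
     (\<forall>k A. block_positive k A \<longrightarrow> block_positive k (\<lambda>a b. \<Lambda> (A a b)))"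

definition quantum_channel :: "(complex^'k^'k \<Rightarrow> complex^'k^'k) \<Rightarrow> bool" where
  "quantum_channel \<Lambda> \<longleftrightarrow> Vector_Spaces.linear cscale cscale \<Lambda> \<and>
     completely_positive \<Lambda> \<and> (\<forall>A. trace (\<Lambda> A) = trace A)"

definition unitary_channel :: "(complex^'k^'k \<Rightarrow> complex^'k^'k) \<Rightarrow> bool" where
  "unitary_channel \<Lambda> \<longleftrightarrow> (\<exists>W. dagger W ** W = mat 1 \<and> W ** dagger W = mat 1 \<and>
     (\<forall>\<rho>. \<Lambda> \<rho> = W ** \<rho> ** dagger W))"

definition hs_adjoint :: "(complex^'k^'k \<Rightarrow> complex^'k^'k) \<Rightarrow> complex^'k^'k \<Rightarrow> complex^'k^'k" where
  "hs_adjoint \<Lambda> = (THE \<Lambda>'. \<forall>A B. hs_inner (\<Lambda>' A) B = hs_inner A (\<Lambda> B))"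

definition ensemble_map :: "'p measure \<Rightarrow> ('p \<Rightarrow> complex^'k^'k) \<Rightarrow> complex^'k^'k \<Rightarrow> complex^'k^'k" where
  "ensemble_map M E \<rho> = (\<integral>\<phi>. E \<phi> ** \<rho> ** dagger (E \<phi>) \<partial>M)"

text \<open>Equality of the mean transfer matrix with that of the mean channel forces the channel to be
  unitary; for the converse the ensemble has to be normalised, the weights of a Kraus decomposition
  being put into the distribution of \<open>\<phi>\<close>.  Otherwise, for a unitary \<open>W\<close> and non-constant moduli
  \<open>\<bar>c\<^sub>\<phi>\<bar>\<close> with mean square \<open>1\<close>, the ensemble \<open>c\<^sub>\<phi> W\<close> has the unitary channel of \<open>W\<close>, but its mean
  transfer matrix is that of the channel multiplied by the mean of \<open>\<bar>c\<^sub>\<phi>\<bar>\<^sup>4\<close>, which exceeds \<open>1\<close>.\<close>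

definition normalized_op :: "complex^'k^'k \<Rightarrow> bool" where
  "normalized_op A \<longleftrightarrow> trace (dagger A ** A) = of_nat CARD('k)"


subsection \<open>Well-definedness\<close>

lemma dagger_nth [simp]: "dagger A $ i $ j = cnj (A $ j $ i)"
  by (simp add: dagger_def)

lemma cscale_nth [simp]: "cscale c A $ i $ j = c * A $ i $ j"
  by (simp add: cscale_def)

lemma dagger_dagger [simp]: "dagger (dagger A) = A"
  by (simp add: vec_eq_iff)

lemma dagger_add: "dagger (A + B) = dagger A + dagger B"
  by (simp add: vec_eq_iff)

lemma dagger_cscale: "dagger (cscale c A) = cscale (cnj c) (dagger A)"
  by (simp add: vec_eq_iff)

lemma hs_inner_sum: "hs_inner A B = (\<Sum>i\<in>UNIV. \<Sum>j\<in>UNIV. cnj (A $ j $ i) * B $ j $ i)"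
  by (simp add: hs_inner_def trace_def matrix_matrix_mult_def)

lemma hs_inner_linear: "Vector_Spaces.linear cscale (*) (hs_inner A)"
  by unfold_locales
     (simp_all add: hs_inner_sum algebra_simps sum.distrib sum_distrib_left)

lemma hs_inner_cnj: "cnj (hs_inner A B) = hs_inner B A"
  by (simp add: hs_inner_sum mult.commute)

lemma Re_hs_inner: "Re (hs_inner A B) = A \<bullet> B"
proof -
  have "Re (hs_inner A B) = (\<Sum>i\<in>UNIV. \<Sum>j\<in>UNIV. (A $ j $ i) \<bullet> (B $ j $ i))"
    by (simp add: hs_inner_sum inner_complex_def)
  also have "\<dots> = (\<Sum>j\<in>UNIV. \<Sum>i\<in>UNIV. (A $ j $ i) \<bullet> (B $ j $ i))"
    by (rule sum.swap)
  finally show ?thesis by (simp add: inner_vec_def)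
qed

lemma hs_inner_dagger: "hs_inner (dagger A) (dagger B) = cnj (hs_inner A B)"
  unfolding hs_inner_sum by (subst sum.swap) simp

lemma hs_inner_hermitian:
  assumes "dagger A = A" "dagger B = B"
  shows "hs_inner A B = of_real (A \<bullet> B)"
proof -
  have "cnj (hs_inner A B) = hs_inner A B"
    using hs_inner_dagger[of A B] assms by simp
  then have "hs_inner A B \<in> \<real>" by (simp add: Reals_cnj_iff)
  then show ?thesis by (metis Re_hs_inner of_real_Re)
qed

lemma hs_inner_ext:
  assumes "\<And>B. hs_inner A B = hs_inner A' B"
  shows "A = A'"
proof -
  have "A \<bullet> B = A' \<bullet> B" for B
    using assms Re_hs_inner by metis
  then show ?thesis by (metis vector_eq_rdot)
qed

lemma hermitian_onb_exists:
  fixes V :: "(complex^'k^'k) set"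
  assumes V: "qop.subspace V" and dag: "\<And>A. A \<in> V \<Longrightarrow> dagger A \<in> V"
  shows "\<exists>\<B>. hermitian_onb V \<B>"
proof -
  define S where "S = {A\<in>V. dagger A = A}"
  have sc: "r *\<^sub>R A = cscale (complex_of_real r) A" for r and A :: "complex^'k^'k"
    by (simp add: vec_eq_iff complex_eq_iff)
  have "subspace S"
    unfolding subspace_def S_def sc
    using V by (auto simp: qop.subspace_0 qop.subspace_add qop.subspace_scale dagger_add dagger_cscale)
       (simp add: vec_eq_iff)
  from orthonormal_basis_subspace[OF this] obtain \<B> where
    sub: "\<B> \<subseteq> S" and orth: "pairwise orthogonal \<B>" and nrm: "\<And>x. x \<in> \<B> \<Longrightarrow> norm x = 1"
    and sp: "span \<B> = S" by metis
  have herm: "dagger B = B" "B \<in> V" if "B \<in> \<B>" for B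
    using sub that by (auto simp: S_def)
  have "hs_inner B C = (if B = C then 1 else 0)" if "B \<in> \<B>" "C \<in> \<B>" for B C
    using hs_inner_hermitian[of B C] herm that orth nrm[of B]
    by (auto simp: pairwise_def orthogonal_def dot_square_norm)
  moreover have "qop.span \<B> = V"
  proof
    show "qop.span \<B> \<subseteq> V" using herm V by (intro qop.span_minimal) auto
    have "S \<subseteq> qop.span \<B>"
      unfolding sp[symmetric]
    proof (rule span_minimal)
      show "\<B> \<subseteq> qop.span \<B>" by (rule qop.span_superset)
      show "subspace (qop.span \<B>)"
        unfolding subspace_def sc by (auto intro: qop.span_zero qop.span_add qop.span_scale)
    qed
    show "V \<subseteq> qop.span \<B>"
    proof
      fix A assume A: "A \<in> V"
      let ?H = "cscale (1/2) (A + dagger A)" and ?K = "cscale (-\<i>/2) (A + cscale (-1) (dagger A))"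
      have "?H \<in> V" "?K \<in> V"
        by (intro qop.subspace_scale[OF V] qop.subspace_add[OF V] A dag[OF A])+
      moreover have "dagger ?H = ?H" "dagger ?K = ?K"
        by (simp_all add: vec_eq_iff algebra_simps)
      ultimately have "?H \<in> S" "?K \<in> S"
        by (simp_all only: S_def mem_Collect_eq simp_thms)
      then have "?H + cscale \<i> ?K \<in> qop.span \<B>"
        using \<open>S \<subseteq> qop.span \<B>\<close> by (intro qop.span_add qop.span_scale[where c = \<i>]) (erule (1) subsetD)+
      moreover have "?H + cscale \<i> ?K = A"
        by (simp add: vec_eq_iff algebra_simps)
      ultimately show "A \<in> qop.span \<B>" by simp
    qed
  qed
  ultimately show ?thesis unfolding hermitian_onb_def using herm by blast
qed

lemma hermitian_onb_finite:
  fixes \<B> :: "(complex^'k^'k) set"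
  assumes "hermitian_onb V \<B>"
  shows "finite \<B>"
proof -
  have "pairwise orthogonal \<B>"
    using assms unfolding hermitian_onb_def pairwise_def orthogonal_def
    by (metis Re_hs_inner zero_complex.simps(1))
  then show ?thesis by (rule pairwise_orthogonal_imp_finite)
qed

lemma hermitian_onb_expand:
  assumes onb: "hermitian_onb V \<B>" and "A \<in> V"
  shows "A = (\<Sum>B\<in>\<B>. cscale (hs_inner B A) B)"
proof -
  have fin: "finite \<B>" using onb by (rule hermitian_onb_finite)
  have "A \<in> qop.span \<B>" using assms by (simp add: hermitian_onb_def)
  then obtain u where A: "A = (\<Sum>B\<in>\<B>. cscale (u B) B)"
    using qop.span_finite[OF fin] by auto
  have "hs_inner C A = u C" if "C \<in> \<B>" for C
  proof -
    interpret l: Vector_Spaces.linear cscale "(*)" "hs_inner C" by (rule hs_inner_linear)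
    have "hs_inner C A = (\<Sum>B\<in>\<B>. u B * hs_inner C B)"
      by (simp add: A l.sum l.scale)
    also have "\<dots> = (\<Sum>B\<in>\<B>. if B = C then u B else 0)"
      using onb that by (intro sum.cong) (auto simp: hermitian_onb_def)
    also have "\<dots> = u C" using fin that by simp
    finally show ?thesis .
  qed
  then show ?thesis using A by simp
qed

lemma hermitian_onb_sum_squares_indep:
  assumes f: "Vector_Spaces.linear cscale (*) f"
    and onb: "hermitian_onb V \<B>" "hermitian_onb V \<C>"
  shows "(\<Sum>B\<in>\<B>. (f B)\<^sup>2) = (\<Sum>C\<in>\<C>. (f C)\<^sup>2)"
proof -
  interpret f: Vector_Spaces.linear cscale "(*)" f by (rule f)
  have mem: "B \<in> V" if "B \<in> \<B>" for B
    using onb that by (auto simp: hermitian_onb_def qop.span_base)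
  have memC: "C \<in> V" if "C \<in> \<C>" for C
    using onb that by (auto simp: hermitian_onb_def qop.span_base)
  have fB: "f B = (\<Sum>C\<in>\<C>. hs_inner C B * f C)" if "B \<in> \<B>" for B
  proof -
    have "f B = f (\<Sum>C\<in>\<C>. cscale (hs_inner C B) C)"
      using hermitian_onb_expand[OF onb(2) mem[OF that]] by simp
    then show ?thesis by (simp add: f.sum f.scale)
  qed
  have sym: "hs_inner C B = hs_inner B C" if "B \<in> \<B>" "C \<in> \<C>" for B C
    using that onb hs_inner_hermitian[of B C] hs_inner_hermitian[of C B]
    by (simp add: hermitian_onb_def inner_commute)
  have parseval: "(\<Sum>B\<in>\<B>. hs_inner C B * hs_inner D B) = hs_inner C D"
    if "C \<in> \<C>" "D \<in> \<C>" for C D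
  proof -
    interpret l: Vector_Spaces.linear cscale "(*)" "hs_inner C" by (rule hs_inner_linear)
    have "hs_inner C D = hs_inner C (\<Sum>B\<in>\<B>. cscale (hs_inner B D) B)"
      using hermitian_onb_expand[OF onb(1) memC[OF that(2)]] by simp
    also have "\<dots> = (\<Sum>B\<in>\<B>. hs_inner B D * hs_inner C B)"
      by (simp add: l.sum l.scale)
    also have "\<dots> = (\<Sum>B\<in>\<B>. hs_inner C B * hs_inner D B)"
      using that by (intro sum.cong) (auto simp: sym)
    finally show ?thesis by simp
  qed
  have "(\<Sum>B\<in>\<B>. (f B)\<^sup>2)
      = (\<Sum>B\<in>\<B>. \<Sum>C\<in>\<C>. \<Sum>D\<in>\<C>. (hs_inner C B * hs_inner D B) * (f C * f D))"
  proof (rule sum.cong[OF refl])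
    fix B assume "B \<in> \<B>"
    then have "(f B)\<^sup>2 = (\<Sum>C\<in>\<C>. hs_inner C B * f C) * (\<Sum>D\<in>\<C>. hs_inner D B * f D)"
      by (simp only: fB power2_eq_square)
    also have "\<dots> = (\<Sum>C\<in>\<C>. \<Sum>D\<in>\<C>. (hs_inner C B * hs_inner D B) * (f C * f D))"
      unfolding sum_product by (simp only: mult.assoc mult.left_commute)
    finally show "(f B)\<^sup>2 = (\<Sum>C\<in>\<C>. \<Sum>D\<in>\<C>. (hs_inner C B * hs_inner D B) * (f C * f D))" .
  qed
  also have "\<dots> = (\<Sum>C\<in>\<C>. \<Sum>B\<in>\<B>. \<Sum>D\<in>\<C>. (hs_inner C B * hs_inner D B) * (f C * f D))"
    by (rule sum.swap)
  also have "\<dots> = (\<Sum>C\<in>\<C>. \<Sum>D\<in>\<C>. \<Sum>B\<in>\<B>. (hs_inner C B * hs_inner D B) * (f C * f D))"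
    by (rule sum.cong[OF refl], rule sum.swap)
  also have "\<dots> = (\<Sum>C\<in>\<C>. \<Sum>D\<in>\<C>. hs_inner C D * (f C * f D))"
    by (rule sum.cong[OF refl], rule sum.cong[OF refl]) (simp add: parseval flip: sum_distrib_right)
  also have "\<dots> = (\<Sum>C\<in>\<C>. \<Sum>D\<in>\<C>. if D = C then (f C)\<^sup>2 else 0)"
    using onb(2) by (rule_tac sum.cong[OF refl], rule_tac sum.cong[OF refl]) (auto simp: hermitian_onb_def power2_eq_square)
  also have "\<dots> = (\<Sum>C\<in>\<C>. (f C)\<^sup>2)"
    using hermitian_onb_finite[OF onb(2)] by simp
  finally show ?thesis .
qed

lemma dagger_tensor_op:
  "dagger (tensor_op g A) = tensor_op g (\<lambda>m x y. cnj (A m y x))"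
  by (simp add: tensor_op_def vec_eq_iff)

lemma locality_space_dagger:
  assumes "A \<in> locality_space g \<kappa>"
  shows "dagger A \<in> locality_space g \<kappa>"
proof -
  let ?G = "{tensor_op g A | A.
     \<forall>m. if \<kappa> m then local_trace (g -` {m}) (A m) = 0 else A m = local_id}"
  have G: "dagger X \<in> ?G" if "X \<in> ?G" for X
  proof -
    from that obtain A where X: "X = tensor_op g A"
      and A: "\<forall>m. if \<kappa> m then local_trace (g -` {m}) (A m) = 0 else A m = local_id" by auto
    have "if \<kappa> m then local_trace (g -` {m}) (\<lambda>x y. cnj (A m y x)) = 0
      else (\<lambda>x y. cnj (A m y x)) = local_id" for m
    proof (cases "\<kappa> m")
      case True
      then have "local_trace (g -` {m}) (A m) = 0" using A by metis
      then have "cnj (local_trace (g -` {m}) (A m)) = 0" by simp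
      then show ?thesis using True by (simp add: local_trace_def)
    next
      case False
      then have "A m = local_id" using A by metis
      then show ?thesis using False by (auto simp: local_id_def fun_eq_iff)
    qed
    then show ?thesis unfolding X dagger_tensor_op by blast
  qed
  have "A \<in> qop.span ?G" using assms by (simp add: locality_space_def)
  then have "dagger A \<in> qop.span ?G"
  proof (induction rule: qop.span_induct_alt)
    case base
    have "dagger 0 = (0 :: 'a qop)" by (simp add: vec_eq_iff)
    then show ?case by (simp add: qop.span_zero)
  next
    case (step c x y)
    then show ?case
      using qop.span_base[OF G[OF step(1)]]
      by (simp only: dagger_add dagger_cscale) (intro qop.span_add qop.span_scale)
  qed
  then show ?thesis by (simp add: locality_space_def)
qed

lemma locality_basis_onb: "hermitian_onb (locality_space g \<kappa>) (locality_basis g \<kappa>)"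
  unfolding locality_basis_def
proof (rule someI_ex, rule hermitian_onb_exists)
  show "qop.subspace (locality_space g \<kappa>)"
    unfolding locality_space_def by (rule qop.subspace_span)
qed (rule locality_space_dagger)

lemma trace_mult_linear: "Vector_Spaces.linear cscale (*) (\<lambda>B. trace (B ** A))"
  by unfold_locales
     (simp_all add: trace_def matrix_matrix_mult_def algebra_simps sum.distrib sum_distrib_left)

lemma trace_mult_linear_right: "Vector_Spaces.linear cscale (*) (\<lambda>B. trace (A ** B))"
  by unfold_locales
     (simp_all add: trace_def matrix_matrix_mult_def algebra_simps sum.distrib sum_distrib_left)

lemma locality_vector_basis_indep:
  assumes "hermitian_onb (locality_space g \<kappa>) \<B>"
  shows "locality_vector g A \<kappa> = (\<Sum>B\<in>\<B>. (trace (B ** A))\<^sup>2)"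
  unfolding locality_vector_def
  by (rule hermitian_onb_sum_squares_indep[OF trace_mult_linear locality_basis_onb assms])

lemma transfer_matrix_basis_indep:
  assumes lin: "Vector_Spaces.linear cscale cscale \<Lambda>"
    and onb: "hermitian_onb (locality_space g \<mu>) \<B>"
  shows "transfer_matrix g \<Lambda> \<kappa> \<mu> =
    (1 / of_nat (qop.dim (locality_space g \<mu>))) * (\<Sum>B\<in>\<B>. locality_vector g (\<Lambda> B) \<kappa>)"
proof -
  have *: "(\<Sum>B\<in>\<C>. locality_vector g (\<Lambda> B) \<kappa>)
      = (\<Sum>C \<in> locality_basis g \<kappa>. \<Sum>B\<in>\<C>. (trace (C ** \<Lambda> B))\<^sup>2)" for \<C>
    unfolding locality_vector_def by (rule sum.swap)
  have "Vector_Spaces.linear cscale (*) ((\<lambda>B. trace (C ** B)) \<circ> \<Lambda>)" for C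
    by (rule Vector_Spaces.linear_compose[OF lin trace_mult_linear_right])
  then have "(\<Sum>B \<in> locality_basis g \<mu>. (trace (C ** \<Lambda> B))\<^sup>2) = (\<Sum>B\<in>\<B>. (trace (C ** \<Lambda> B))\<^sup>2)" for C
    using hermitian_onb_sum_squares_indep[OF _ locality_basis_onb onb, of "\<lambda>B. trace (C ** \<Lambda> B)"]
    by (simp add: comp_def)
  then show ?thesis unfolding transfer_matrix_def * by simp
qed

lemma transfer_matrix_real:
  assumes "\<And>A. dagger A = A \<Longrightarrow> dagger (\<Lambda> A) = \<Lambda> A"
  shows "transfer_matrix g \<Lambda> \<kappa> \<mu> \<in> \<real>"
proof -
  have herm: "dagger B = B" if "B \<in> locality_basis g \<nu>" for B \<nu>
    using locality_basis_onb[of g \<nu>] that by (simp add: hermitian_onb_def)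
  have "trace (B ** \<Lambda> C) \<in> \<real>" if "B \<in> locality_basis g \<kappa>" "C \<in> locality_basis g \<mu>" for B C
    using hs_inner_hermitian[of B "\<Lambda> C"] herm[OF that(1)] assms[OF herm[OF that(2)]]
    by (simp add: hs_inner_def)
  then show ?thesis
    unfolding transfer_matrix_def locality_vector_def
    by (intro Reals_mult Reals_divide sum_in_Reals Reals_power Reals_1 Reals_of_nat) auto
qed

lemma hs_adjoint_unique:
  assumes "\<And>A B. hs_inner (\<Lambda>' A) B = hs_inner A (\<Lambda> B)"
  shows "hs_adjoint \<Lambda> = \<Lambda>'"
  unfolding hs_adjoint_def
proof (rule the_equality)
  show "\<forall>A B. hs_inner (\<Lambda>' A) B = hs_inner A (\<Lambda> B)" using assms by simp
  fix \<Lambda>'' assume "\<forall>A B. hs_inner (\<Lambda>'' A) B = hs_inner A (\<Lambda> B)"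
  then show "\<Lambda>'' = \<Lambda>'" using assms by (intro ext hs_inner_ext) simp
qed

lemma hs_adjoint_works:
  fixes \<Lambda> :: "complex^'k^'k \<Rightarrow> complex^'k^'k"
  assumes lin: "Vector_Spaces.linear cscale cscale \<Lambda>"
  shows "hs_inner (hs_adjoint \<Lambda> A) B = hs_inner A (\<Lambda> B)"
proof -
  have "hermitian_onb UNIV (SOME \<B>. hermitian_onb UNIV (\<B> :: (complex^'k^'k) set))"
    by (rule someI_ex, rule hermitian_onb_exists) (simp_all add: qop.subspace_UNIV)
  then obtain \<B> where onb: "hermitian_onb UNIV (\<B> :: (complex^'k^'k) set)" by blast
  interpret \<Lambda>: Vector_Spaces.linear cscale cscale \<Lambda> by (rule lin)
  define L where "L A = (\<Sum>C\<in>\<B>. cscale (hs_inner (\<Lambda> C) A) C)" for A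
  have "hs_inner (L A) B = hs_inner A (\<Lambda> B)" for A B
  proof -
    interpret a: Vector_Spaces.linear cscale "(*)" "hs_inner A" by (rule hs_inner_linear)
    interpret b: Vector_Spaces.linear cscale "(*)" "hs_inner B" by (rule hs_inner_linear)
    have "hs_inner A (\<Lambda> B) = hs_inner A (\<Lambda> (\<Sum>C\<in>\<B>. cscale (hs_inner C B) C))"
      using hermitian_onb_expand[OF onb, of B] by simp
    also have "\<dots> = (\<Sum>C\<in>\<B>. hs_inner C B * hs_inner A (\<Lambda> C))"
      by (simp add: \<Lambda>.sum \<Lambda>.scale a.sum a.scale)
    also have "\<dots> = cnj (\<Sum>C\<in>\<B>. hs_inner (\<Lambda> C) A * hs_inner B C)"
      by (simp add: hs_inner_cnj mult.commute)
    also have "\<dots> = cnj (hs_inner B (L A))"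
      by (simp add: L_def b.sum b.scale)
    finally show ?thesis by (simp add: hs_inner_cnj)
  qed
  then have "hs_adjoint \<Lambda> = L" by (intro hs_adjoint_unique)
  with \<open>\<And>A B. hs_inner (L A) B = hs_inner A (\<Lambda> B)\<close> show ?thesis by simp
qed

end

theory Submission
  imports Defs
begin

text \<open>For Hermitian basis elements \<open>B\<close>, \<open>C\<close> the number \<open>Tr[C E\<^sub>\<phi>\<^sup>\<dagger> B E\<^sub>\<phi>]\<close> is real with mean
  \<open>Tr[C \<E>\<^sup>\<dagger>(B)]\<close>, and the transfer matrices are weighted sums of its square, respectively of the
  square of its mean; the inequality is nonnegativity of the variance.  Equality in all entries makes
  every such number almost surely constant.  Since the locality spaces together span all operators,
  \<open>E\<^sub>\<phi>\<^sup>\<dagger> A E\<^sub>\<phi> = \<E>\<^sup>\<dagger>(A)\<close> for all \<open>A\<close>, almost surely; a single such \<open>E\<^sub>\<phi>\<close> is the unitary sought.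
  Conversely, if \<open>\<E>(\<rho>) = W \<rho> W\<^sup>\<dagger>\<close> on a space of dimension \<open>N\<close>, then \<open>|Tr[W\<^sup>\<dagger> E\<^sub>\<phi>]|\<^sup>2\<close> has mean
  \<open>N\<^sup>2\<close>, the maximum that Cauchy-Schwarz allows for normalised \<open>E\<^sub>\<phi>\<close>, so \<open>E\<^sub>\<phi>\<close> is almost surely
  \<open>W\<close> up to a phase.\<close>

section \<open>Conjugation maps and Hilbert-Schmidt adjoints\<close>

lemma dagger_mult: "dagger (A ** B) = dagger B ** dagger A"
  by (simp add: vec_eq_iff matrix_matrix_mult_def mult.commute)

lemma dagger_mat_1: "dagger (mat 1) = mat 1"
  by (simp add: vec_eq_iff mat_def)

text \<open>Cyclicity of the trace; this makes conjugation by \<open>dagger X\<close> the adjoint of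
  conjugation by \<open>X\<close>.\<close>

lemma hs_inner_conjugation:
  "hs_inner (dagger X ** A ** X) B = hs_inner A (X ** B ** dagger X)"
proof -
  have "hs_inner (dagger X ** A ** X) B = trace ((dagger X ** dagger A ** X) ** B)"
    by (simp add: hs_inner_def dagger_mult matrix_mul_assoc)
  also have "\<dots> = trace (dagger X ** (dagger A ** X ** B))"
    by (simp add: matrix_mul_assoc)
  also have "\<dots> = trace ((dagger A ** X ** B) ** dagger X)"
    by (rule trace_mul_sym)
  finally show ?thesis by (simp add: hs_inner_def matrix_mul_assoc)
qed

lemma inner_conjugation: "(dagger X ** A ** X) \<bullet> B = A \<bullet> (X ** B ** dagger X)"
  by (metis Re_hs_inner hs_inner_conjugation)

lemma dagger_conjugation:
  "dagger A = A \<Longrightarrow> dagger (dagger X ** A ** X) = dagger X ** A ** X"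
  by (simp add: dagger_mult matrix_mul_assoc)

lemma linear_conjugation: "Vector_Spaces.linear cscale cscale (\<lambda>A. X ** A ** Y)"
  by unfold_locales
     (simp_all add: vec_eq_iff matrix_matrix_mult_def algebra_simps sum.distrib
        sum_distrib_left sum_distrib_right)

lemma hs_inner_eq_on_span:
  assumes "A \<in> qop.span S" and "\<And>B. B \<in> S \<Longrightarrow> hs_inner X B = hs_inner Y B"
  shows "hs_inner X A = hs_inner Y A"
proof -
  interpret x: Vector_Spaces.linear cscale "(*)" "hs_inner X" by (rule hs_inner_linear)
  interpret y: Vector_Spaces.linear cscale "(*)" "hs_inner Y" by (rule hs_inner_linear)
  from assms(1) show ?thesis
    by (induction rule: qop.span_induct_alt)
       (simp_all add: x.zero y.zero x.add y.add x.scale y.scale assms(2))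
qed

lemma linear_hs_adjoint:
  assumes "Vector_Spaces.linear cscale cscale \<Lambda>"
  shows "Vector_Spaces.linear cscale cscale (hs_adjoint \<Lambda>)"
proof -
  have add: "hs_inner (A + A') B = hs_inner A B + hs_inner A' B" for A A' B :: "complex^'a^'a"
    by (simp add: hs_inner_sum algebra_simps sum.distrib)
  have scale: "hs_inner (cscale c A) B = cnj c * hs_inner A B" for c and A B :: "complex^'a^'a"
    by (simp add: hs_inner_sum algebra_simps sum_distrib_left)
  have "hs_adjoint \<Lambda> (A + B) = hs_adjoint \<Lambda> A + hs_adjoint \<Lambda> B" for A B
    by (rule hs_inner_ext) (simp add: add hs_adjoint_works[OF assms])
  moreover have "hs_adjoint \<Lambda> (cscale c A) = cscale c (hs_adjoint \<Lambda> A)" for c A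
    by (rule hs_inner_ext) (simp add: scale hs_adjoint_works[OF assms])
  ultimately show ?thesis by unfold_locales
qed

text \<open>Taking daggers of both arguments conjugates the product, so compatibility with
  \<open>dagger\<close> carries over to the adjoint.\<close>

lemma hs_adjoint_hermitian:
  assumes lin: "Vector_Spaces.linear cscale cscale \<Lambda>"
    and dag: "\<And>A. \<Lambda> (dagger A) = dagger (\<Lambda> A)" and "dagger A = A"
  shows "dagger (hs_adjoint \<Lambda> A) = hs_adjoint \<Lambda> A"
proof (rule hs_inner_ext)
  fix B
  have "hs_inner (dagger (hs_adjoint \<Lambda> A)) B = cnj (hs_inner A (\<Lambda> (dagger B)))"
    using hs_inner_dagger[of "hs_adjoint \<Lambda> A" "dagger B"] by (simp add: hs_adjoint_works[OF lin])
  also have "\<dots> = hs_inner A (\<Lambda> B)"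
    using hs_inner_dagger[of A "dagger (\<Lambda> B)"] by (simp add: dag assms(3))
  finally show "hs_inner (dagger (hs_adjoint \<Lambda> A)) B = hs_inner (hs_adjoint \<Lambda> A) B"
    by (simp add: hs_adjoint_works[OF lin])
qed

section \<open>Transfer matrices as weighted sums of real squares\<close>

text \<open>Between Hermitian operators the trace product is the real Euclidean inner product, so
  the complex squares are squares of reals. Indexing by pairs gives one finite sum, the form needed
  for the variance argument.\<close>

lemma Re_transfer_matrix:
  assumes "\<And>A. dagger A = A \<Longrightarrow> dagger (\<Lambda> A) = \<Lambda> A"
  shows "Re (transfer_matrix g \<Lambda> \<kappa> \<mu>) = 1 / of_nat (qop.dim (locality_space g \<mu>)) *
    (\<Sum>(B, C) \<in> locality_basis g \<mu> \<times> locality_basis g \<kappa>. (\<Lambda> B \<bullet> C)\<^sup>2)"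
proof -
  have herm: "dagger B = B" if "B \<in> locality_basis g \<nu>" for B \<nu>
    using locality_basis_onb[of g \<nu>] that by (simp add: hermitian_onb_def)
  have "trace (C ** \<Lambda> B) = of_real (\<Lambda> B \<bullet> C)"
    if "B \<in> locality_basis g \<mu>" "C \<in> locality_basis g \<kappa>" for B C
    using hs_inner_hermitian[of C "\<Lambda> B"] herm[OF that(2)] assms[OF herm[OF that(1)]]
    by (simp add: hs_inner_def inner_commute)
  then have "(\<Sum>B \<in> locality_basis g \<mu>. locality_vector g (\<Lambda> B) \<kappa>)
    = of_real (\<Sum>(B, C) \<in> locality_basis g \<mu> \<times> locality_basis g \<kappa>. (\<Lambda> B \<bullet> C)\<^sup>2)"
    by (simp add: locality_vector_def flip: sum.cartesian_product)
  then have "transfer_matrix g \<Lambda> \<kappa> \<mu> = of_real (1 / of_nat (qop.dim (locality_space g \<mu>)) *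
    (\<Sum>(B, C) \<in> locality_basis g \<mu> \<times> locality_basis g \<kappa>. (\<Lambda> B \<bullet> C)\<^sup>2))"
    unfolding transfer_matrix_def by simp
  then show ?thesis by (metis Re_complex_of_real)
qed

text \<open>An orthonormal basis is independent, so its cardinality is the dimension. This keeps the
  weight \<open>1 / dim\<close> away from the HOL value \<open>1 / 0 = 0\<close>, so that it can be
  cancelled in the equality case.\<close>

lemma dim_locality_space_pos:
  assumes "B \<in> locality_basis g \<mu>"
  shows "qop.dim (locality_space g \<mu>) > 0"
proof -
  note onb = locality_basis_onb[of g \<mu>]
  have "B \<noteq> 0"
  proof
    assume "B = 0"
    then have "hs_inner B B = 0" by (simp add: hs_inner_sum)
    then show False using onb assms by (simp add: hermitian_onb_def)
  qed
  have "qop.independent (locality_basis g \<mu>)"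
    unfolding qop.dependent_finite[OF hermitian_onb_finite[OF onb]]
  proof safe
    fix u C assume C: "C \<in> locality_basis g \<mu>" "u C \<noteq> 0"
      and z: "(\<Sum>B\<in>locality_basis g \<mu>. cscale (u B) B) = 0"
    interpret l: Vector_Spaces.linear cscale "(*)" "hs_inner C" by (rule hs_inner_linear)
    have "0 = hs_inner C (\<Sum>B\<in>locality_basis g \<mu>. cscale (u B) B)" by (simp add: z l.zero)
    also have "\<dots> = (\<Sum>B\<in>locality_basis g \<mu>. if B = C then u B else 0)"
      using onb C(1) by (auto simp: l.sum l.scale hermitian_onb_def intro!: sum.cong)
    also have "\<dots> = u C" using C(1) hermitian_onb_finite[OF onb] by simp
    finally show False using C(2) by simp
  qed
  moreover have "qop.span (locality_basis g \<mu>) = qop.span (locality_space g \<mu>)"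
    using onb by (simp add: hermitian_onb_def locality_space_def qop.span_span)
  ultimately have "qop.dim (locality_space g \<mu>) = card (locality_basis g \<mu>)"
    by (intro qop.dim_eq_card)
  then show ?thesis using assms hermitian_onb_finite[OF onb] by (auto simp: card_gt_0_iff)
qed

text \<open>\<open>dagger\<close> is conjugate-linear, hence real-linear, hence bounded linear in
  finite dimension; so it passes through the Bochner integral.\<close>

lemma dagger_integral:
  fixes f :: "'p \<Rightarrow> complex^'k^'k"
  assumes "integrable M f"
  shows "dagger (\<integral>x. f x \<partial>M) = (\<integral>x. dagger (f x) \<partial>M)"
proof -
  have "linear (dagger :: complex^'k^'k \<Rightarrow> complex^'k^'k)"
    by (rule linearI) (simp_all add: vec_eq_iff)
  then have "bounded_linear (dagger :: complex^'k^'k \<Rightarrow> complex^'k^'k)"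
    by (simp add: linear_conv_bounded_linear)
  from integral_bounded_linear[OF this assms] show ?thesis by simp
qed

lemma ensemble_map_dagger:
  assumes "\<And>\<rho>. integrable M (\<lambda>\<phi>. E \<phi> ** \<rho> ** dagger (E \<phi>))"
  shows "ensemble_map M E (dagger A) = dagger (ensemble_map M E A)"
  unfolding ensemble_map_def dagger_integral[OF assms]
  by (simp add: dagger_mult matrix_mul_assoc)

section \<open>The locality spaces span all operators\<close>

text \<open>Each factor is a multiple of the identity plus a traceless part. Multiplying out gives
  one term for each set \<open>X\<close> of factors that contribute their traceless part.\<close>

lemma tensor_op_in_span_locality_spaces:
  fixes g :: "'n::finite \<Rightarrow> 'm::finite"
  shows "tensor_op g A \<in> qop.span (\<Union>\<kappa>. locality_space g \<kappa>)"
proof -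
  \<comment> \<open>Normalised trace: the cardinality is the dimension of the factor, which makes
    \<open>T m\<close> below traceless.\<close>
  define c where "c m = local_trace (g -` {m}) (A m) / of_nat (card (PiE (g -` {m}) (\<lambda>_. UNIV :: bool set)))" for m
  define T where "T m x y = A m x y - c m * local_id x y" for m x y
  have "PiE (g -` {m}) (\<lambda>_. UNIV :: bool set) \<noteq> {}" "finite (PiE (g -` {m}) (\<lambda>_. UNIV :: bool set))" for m
    by (simp_all add: PiE_eq_empty_iff finite_PiE)
  then have T: "local_trace (g -` {m}) (T m) = 0" for m
    by (simp add: local_trace_def T_def c_def local_id_def sum_subtractf)
  define B where "B X m = (if m \<in> X then T m else local_id)" for X m
  have mem: "tensor_op g (B X) \<in> locality_space g (\<lambda>m. m \<in> X)" for X
    unfolding locality_space_def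
    by (rule qop.span_base) (use T in \<open>auto simp: B_def intro!: exI[of _ "B X"]\<close>)
  have "tensor_op g A = (\<Sum>X\<in>Pow UNIV. cscale (\<Prod>m\<in>-X. c m) (tensor_op g (B X)))"
  proof (simp only: vec_eq_iff sum_component, intro allI)
    fix x y :: "'n \<Rightarrow> bool"
    let ?x = "\<lambda>m. restrict x (g -` {m})" and ?y = "\<lambda>m. restrict y (g -` {m})"
    have "tensor_op g A $ x $ y = (\<Prod>m\<in>UNIV. T m (?x m) (?y m) + c m * local_id (?x m) (?y m))"
      by (simp add: tensor_op_def T_def)
    also have "\<dots> = (\<Sum>X\<in>Pow UNIV. (\<Prod>m\<in>X. T m (?x m) (?y m)) * (\<Prod>m\<in>-X. c m * local_id (?x m) (?y m)))"
      by (simp add: prod_add Compl_eq_Diff_UNIV)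
    also have "\<dots> = (\<Sum>X\<in>Pow UNIV. cscale (\<Prod>m\<in>-X. c m) (tensor_op g (B X)) $ x $ y)"
    proof (rule sum.cong[OF refl])
      fix X
      have "(\<Prod>m\<in>UNIV. B X m (?x m) (?y m))
        = (\<Prod>m\<in>X. B X m (?x m) (?y m)) * (\<Prod>m\<in>-X. B X m (?x m) (?y m))"
        by (subst prod.union_disjoint[symmetric]) auto
      then show "(\<Prod>m\<in>X. T m (?x m) (?y m)) * (\<Prod>m\<in>-X. c m * local_id (?x m) (?y m))
        = cscale (\<Prod>m\<in>-X. c m) (tensor_op g (B X)) $ x $ y"
        by (simp add: tensor_op_def B_def prod.distrib)
    qed
    finally show "tensor_op g A $ x $ y = (\<Sum>X\<in>Pow UNIV. cscale (\<Prod>m\<in>-X. c m) (tensor_op g (B X)) $ x $ y)" .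
  qed
  also have "\<dots> \<in> qop.span (\<Union>\<kappa>. locality_space g \<kappa>)"
    by (intro qop.span_sum qop.span_scale qop.span_base) (use mem in blast)
  finally show ?thesis .
qed

text \<open>Matrix units of the whole space are tensor products of local matrix units, and every
  operator is a combination of matrix units.\<close>

lemma span_locality_spaces:
  fixes g :: "'n::finite \<Rightarrow> 'm::finite"
  shows "qop.span (\<Union>\<kappa>. locality_space g \<kappa>) = UNIV"
proof (intro set_eqI iffI UNIV_I)
  fix A :: "'n qop"
  define U where "U a b m x y = (if x = restrict a (g -` {m}) \<and> y = restrict b (g -` {m}) then 1 else 0 :: complex)"
    for a b :: "'n \<Rightarrow> bool" and m :: 'm and x y
  \<comment> \<open>The fibres of \<open>g\<close> cover all qubits, so a bit assignment is
    determined by its restrictions to them.\<close>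
  have restr: "(\<forall>m. restrict x (g -` {m}) = restrict a (g -` {m})) \<longleftrightarrow> x = a" for x a :: "'n \<Rightarrow> bool"
    by (auto simp: fun_eq_iff restrict_def split: if_splits)
  have U: "tensor_op g (U a b) $ x $ y = (if x = a \<and> y = b then 1 else 0)" for a b x y
  proof -
    have "tensor_op g (U a b) $ x $ y = (\<Prod>m\<in>UNIV. if restrict x (g -` {m}) = restrict a (g -` {m}) \<and>
        restrict y (g -` {m}) = restrict b (g -` {m}) then 1 else 0)"
      by (simp add: tensor_op_def U_def)
    also have "\<dots> = (if \<forall>m. restrict x (g -` {m}) = restrict a (g -` {m}) \<and>
        restrict y (g -` {m}) = restrict b (g -` {m}) then 1 else 0)"
      by (auto intro!: prod.neutral simp: prod_zero_iff)
    finally show ?thesis by (simp add: all_conj_distrib restr)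
  qed
  have "A = (\<Sum>(a, b)\<in>UNIV. cscale (A $ a $ b) (tensor_op g (U a b)))"
  proof (simp only: vec_eq_iff sum_component, intro allI)
    fix x y
    have "(\<Sum>p\<in>UNIV. (case p of (a, b) \<Rightarrow> cscale (A $ a $ b) (tensor_op g (U a b))) $ x $ y)
      = (\<Sum>p\<in>UNIV. if p = (x, y) then A $ x $ y else 0)"
      by (intro sum.cong) (auto simp: U split: if_splits)
    then show "A $ x $ y = (\<Sum>p\<in>UNIV. (case p of (a, b) \<Rightarrow> cscale (A $ a $ b) (tensor_op g (U a b))) $ x $ y)"
      by simp
  qed
  also have "\<dots> \<in> qop.span (\<Union>\<kappa>. locality_space g \<kappa>)"
    by (intro qop.span_sum) (auto intro!: qop.span_scale tensor_op_in_span_locality_spaces)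
  finally show "A \<in> qop.span (\<Union>\<kappa>. locality_space g \<kappa>)" .
qed

lemma span_locality_bases:
  fixes g :: "'n::finite \<Rightarrow> 'm::finite"
  shows "qop.span (\<Union>\<kappa>. locality_basis g \<kappa>) = UNIV"
proof -
  have "locality_space g \<kappa> \<subseteq> qop.span (\<Union>\<kappa>. locality_basis g \<kappa>)" for \<kappa>
    using locality_basis_onb[of g \<kappa>] qop.span_mono[of "locality_basis g \<kappa>" "\<Union>\<kappa>. locality_basis g \<kappa>"]
    by (auto simp: hermitian_onb_def)
  then have "qop.span (\<Union>\<kappa>. locality_space g \<kappa>) \<subseteq> qop.span (\<Union>\<kappa>. locality_basis g \<kappa>)"
    by (intro qop.span_minimal) (auto simp: qop.subspace_span)
  then show ?thesis using span_locality_spaces[of g] by (simp add: top_unique)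
qed

section \<open>The variance inequality and its equality case\<close>

text \<open>A sum of variances is nonnegative, and if it vanishes each variable is almost surely its
  mean. The squares need not be integrable: with an infinite integral the inequality is trivial and
  equality with a finite value impossible.\<close>

lemma nn_integral_sum_squares:
  fixes X :: "'i \<Rightarrow> 'p \<Rightarrow> real"
  assumes "prob_space M" and "finite I" and X: "\<And>i. i \<in> I \<Longrightarrow> integrable M (X i)" and w: "0 \<le> w"
  shows "ennreal (w * (\<Sum>i\<in>I. (\<integral>x. X i x \<partial>M)\<^sup>2)) \<le> (\<integral>\<^sup>+x. ennreal (w * (\<Sum>i\<in>I. (X i x)\<^sup>2)) \<partial>M)"
    (is "ennreal ?l \<le> ?r")
    and "\<lbrakk>(\<integral>\<^sup>+x. ennreal (w * (\<Sum>i\<in>I. (X i x)\<^sup>2)) \<partial>M) = ennreal (w * (\<Sum>i\<in>I. (\<integral>x. X i x \<partial>M)\<^sup>2));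
      0 < w; i \<in> I\<rbrakk> \<Longrightarrow> AE x in M. X i x = (\<integral>x. X i x \<partial>M)"
proof -
  interpret prob_space M by fact
  define S where "S x = w * (\<Sum>i\<in>I. (X i x)\<^sup>2)" for x
  define m where "m i = (\<integral>x. X i x \<partial>M)" for i
  \<comment> \<open>Pointwise \<open>S = D + 2 w \<Sum> m\<^sub>i X\<^sub>i - w \<Sum> m\<^sub>i\<^sup>2\<close>, so the integrals of \<open>S\<close> and \<open>D\<close> differ by the left-hand side.\<close>
  define D where "D x = w * (\<Sum>i\<in>I. (X i x - m i)\<^sup>2)" for x
  have S0: "0 \<le> S x" and D0: "0 \<le> D x" for x
    using w by (auto simp: S_def D_def intro!: mult_nonneg_nonneg sum_nonneg)
  have meas[measurable]: "X i \<in> borel_measurable M" if "i \<in> I" for i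
    using X[OF that] by simp
  have measS: "S \<in> borel_measurable M"
    unfolding S_def by measurable
  have var: "integrable M D" "(\<integral>x. S x \<partial>M) = (\<integral>x. D x \<partial>M) + ?l" if S: "integrable M S"
  proof -
    have DS: "D x = S x - 2 * w * (\<Sum>i\<in>I. m i * X i x) + w * (\<Sum>i\<in>I. (m i)\<^sup>2)" for x
      by (simp add: D_def S_def power2_diff sum.distrib sum_subtractf sum_distrib_left algebra_simps)
    show "integrable M D"
      unfolding DS using S X by (intro Bochner_Integration.integrable_add
          Bochner_Integration.integrable_diff integrable_mult_right Bochner_Integration.integrable_sum) auto
    have "(\<integral>x. D x \<partial>M) = (\<integral>x. S x \<partial>M) - 2 * w * (\<Sum>i\<in>I. m i * m i) + w * (\<Sum>i\<in>I. (m i)\<^sup>2)"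
      unfolding DS using S X by (simp add: m_def prob_space)
    then show "(\<integral>x. S x \<partial>M) = (\<integral>x. D x \<partial>M) + ?l"
      by (simp add: m_def power2_eq_square)
  qed
  have nnS: "?r = ennreal (\<integral>x. S x \<partial>M)" if "integrable M S"
    using nn_integral_eq_integral[OF that] S0 by (simp flip: S_def)
  have intS: "integrable M S" if "?r < \<infinity>"
    using that S0 measS by (intro integrableI_nonneg) (auto simp: S_def)
  show "ennreal ?l \<le> ?r"
  proof (cases "?r < \<infinity>")
    case True
    then show ?thesis using var[OF intS] nnS[OF intS] D0 by (simp add: ennreal_leI)
  next
    case False
    then show ?thesis by (simp add: less_top[symmetric])
  qed
  assume eq: "?r = ennreal ?l" and w0: "0 < w" and i: "i \<in> I"
  have l0: "0 \<le> ?l" using w by (auto intro!: mult_nonneg_nonneg sum_nonneg)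
  have int: "integrable M S" using eq by (intro intS) simp
  then have "(\<integral>x. S x \<partial>M) = ?l"
    using eq nnS l0 S0 by (simp add: Bochner_Integration.integral_nonneg)
  then have "(\<integral>x. D x \<partial>M) = 0" using var(2)[OF int] by simp
  then have "AE x in M. D x = 0"
    using integral_nonneg_eq_0_iff_AE[OF var(1)[OF int]] D0 by simp
  then show "AE x in M. X i x = (\<integral>x. X i x \<partial>M)"
  proof eventually_elim
    case (elim x)
    then have "(\<Sum>i\<in>I. (X i x - m i)\<^sup>2) = 0" using w0 by (simp add: D_def)
    then have "(X i x - m i)\<^sup>2 = 0" using i \<open>finite I\<close> by (subst (asm) sum_nonneg_eq_0_iff) auto
    then show ?case by (simp add: m_def)
  qed
qed

section \<open>Unitary channels and their ensembles\<close>

lemma hs_adjoint_trace_preserving_unital: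
  assumes "Vector_Spaces.linear cscale cscale \<Lambda>" and "\<And>A. trace (\<Lambda> A) = trace A"
  shows "hs_adjoint \<Lambda> (mat 1) = mat 1"
  by (rule hs_inner_ext) (subst hs_adjoint_works[OF assms(1)], simp add: hs_inner_def dagger_mat_1 assms(2))

lemma conjugation_matrix_unit:
  "(X ** (\<chi> x y. if x = j \<and> y = l then 1 else 0) ** dagger X) $ i $ k = X $ i $ j * cnj (X $ k $ l)"
proof -
  have "(X ** (\<chi> x y. if x = j \<and> y = l then 1 else 0) ** dagger X) $ i $ k
    = (\<Sum>y\<in>UNIV. \<Sum>x\<in>UNIV. X $ i $ x * (if x = j \<and> y = l then 1 else 0) * cnj (X $ k $ y))"
    by (simp add: matrix_matrix_mult_def sum_distrib_right)
  also have "\<dots> = (\<Sum>y\<in>UNIV. \<Sum>x\<in>UNIV. if x = j then if y = l then X $ i $ x * cnj (X $ k $ y) else 0 else 0)"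
    by (intro sum.cong refl) simp
  finally show ?thesis by simp
qed

text \<open>Conjugating a matrix unit produces products of two entries of \<open>E \<phi>\<close>.
  So all second moments exist, and the mean channel determines them.\<close>

lemma integrable_ensemble_products:
  fixes E :: "'p \<Rightarrow> complex^'k^'k"
  assumes E: "\<And>\<rho>. integrable M (\<lambda>\<phi>. E \<phi> ** \<rho> ** dagger (E \<phi>))"
  shows "integrable M (\<lambda>\<phi>. E \<phi> $ i $ j * cnj (E \<phi> $ k $ l))"
    and "(\<integral>\<phi>. E \<phi> $ i $ j * cnj (E \<phi> $ k $ l) \<partial>M)
      = ensemble_map M E (\<chi> x y. if x = j \<and> y = l then 1 else 0) $ i $ k"
proof -
  define \<rho> :: "complex^'k^'k" where "\<rho> = (\<chi> x y. if x = j \<and> y = l then 1 else 0)"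
  have bl: "bounded_linear (\<lambda>A :: complex^'k^'k. A $ i $ k)"
    by (intro bounded_linear_compose[OF bounded_linear_vec_nth] bounded_linear_vec_nth)
  have entry: "(X ** \<rho> ** dagger X) $ i $ k = X $ i $ j * cnj (X $ k $ l)" for X
    unfolding \<rho>_def by (rule conjugation_matrix_unit)
  show "integrable M (\<lambda>\<phi>. E \<phi> $ i $ j * cnj (E \<phi> $ k $ l))"
    using integrable_bounded_linear[OF bl E[of \<rho>]] by (simp add: entry)
  show "(\<integral>\<phi>. E \<phi> $ i $ j * cnj (E \<phi> $ k $ l) \<partial>M)
      = ensemble_map M E (\<chi> x y. if x = j \<and> y = l then 1 else 0) $ i $ k"
    using integral_bounded_linear[OF bl E[of \<rho>]]
    by (simp add: entry ensemble_map_def flip: \<rho>_def)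
qed

text \<open>Pythagoras for the projection of \<open>A\<close> onto the line through
  \<open>W\<close>. The right-hand side is the Cauchy-Schwarz defect, zero only if \<open>A\<close>
  is a multiple of \<open>W\<close>.\<close>

lemma norm_hs_inner_defect:
  fixes A W :: "complex^'k^'k"
  assumes "hs_inner W W = of_nat N" "hs_inner A A = of_nat N" "0 < N"
  shows "(norm (A - cscale (hs_inner W A / of_nat N) W))\<^sup>2 = N - (cmod (hs_inner W A))\<^sup>2 / N"
proof -
  define c where "c = hs_inner W A / of_nat N"
  interpret w: Vector_Spaces.linear cscale "(*)" "hs_inner W" by (rule hs_inner_linear)
  interpret a: Vector_Spaces.linear cscale "(*)" "hs_inner A" by (rule hs_inner_linear)
  interpret d: Vector_Spaces.linear cscale "(*)" "hs_inner (A - cscale c W)" by (rule hs_inner_linear)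
  have W0: "hs_inner W (A - cscale c W) = 0"
    using assms by (simp add: w.diff w.scale c_def)
  then have W0': "hs_inner (A - cscale c W) W = 0"
    using hs_inner_cnj[of W "A - cscale c W"] by simp
  have "hs_inner (A - cscale c W) (A - cscale c W) = hs_inner (A - cscale c W) A"
    by (simp add: d.diff d.scale W0')
  also have "\<dots> = cnj (hs_inner A (A - cscale c W))" by (simp add: hs_inner_cnj)
  also have "\<dots> = of_nat N - cnj c * hs_inner W A"
    by (simp add: a.diff a.scale assms hs_inner_cnj)
  also have "\<dots> = of_real (N - (cmod (hs_inner W A))\<^sup>2 / N)"
    using assms(3) complex_norm_square[of "hs_inner W A"] by (simp add: c_def field_simps)
  finally have "Re (hs_inner (A - cscale c W) (A - cscale c W)) = N - (cmod (hs_inner W A))\<^sup>2 / N"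
    by (metis Re_complex_of_real)
  then show ?thesis by (simp add: Re_hs_inner power2_norm_eq_inner c_def)
qed

text \<open>The squared modulus of \<open>hs_inner W (E \<phi>)\<close> is a combination of second
  moments, so its mean is the value for the constant ensemble \<open>W\<close>. The Cauchy-Schwarz
  defect \<open>h\<close> is thus almost surely nonnegative with mean 0, and vanishes.\<close>

lemma unitary_ensemble_proportional:
  fixes E :: "'p \<Rightarrow> complex^'k^'k"
  assumes "prob_space M"
    and E: "\<And>\<rho>. integrable M (\<lambda>\<phi>. E \<phi> ** \<rho> ** dagger (E \<phi>))"
    and W: "dagger W ** W = mat 1" "\<And>\<rho>. ensemble_map M E \<rho> = W ** \<rho> ** dagger W"
    and nrm: "AE \<phi> in M. normalized_op (E \<phi>)"
  shows "AE \<phi> in M. \<exists>c. cmod c = 1 \<and> E \<phi> = cscale c W"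
proof -
  interpret prob_space M by fact
  let ?N = "CARD('k)"
  have WW: "hs_inner W W = of_nat ?N" by (simp add: hs_inner_def W trace_I)
  define f where "f \<phi> = complex_of_real ((cmod (hs_inner W (E \<phi>)))\<^sup>2)" for \<phi>
  have f: "f \<phi> = (\<Sum>l\<in>UNIV. \<Sum>k\<in>UNIV. \<Sum>j\<in>UNIV. \<Sum>i\<in>UNIV.
      cnj (W $ i $ j) * W $ k $ l * (E \<phi> $ i $ j * cnj (E \<phi> $ k $ l)))" for \<phi>
    by (simp only: f_def complex_norm_square hs_inner_sum cnj_sum sum_product sum_distrib_left sum_distrib_right)
       (simp add: algebra_simps)
  note int = integrable_ensemble_products[OF E]
  have fint: "integrable M f"
    unfolding f by (intro Bochner_Integration.integrable_sum integrable_mult_right int)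
  have "(\<integral>\<phi>. f \<phi> \<partial>M) = (\<Sum>l\<in>UNIV. \<Sum>k\<in>UNIV. \<Sum>j\<in>UNIV. \<Sum>i\<in>UNIV.
      cnj (W $ i $ j) * W $ k $ l * (W $ i $ j * cnj (W $ k $ l)))"
    unfolding f by (simp add: int Bochner_Integration.integrable_sum W(2) conjugation_matrix_unit)
  also have "\<dots> = hs_inner W W * hs_inner W W"
    by (simp only: hs_inner_sum sum_product sum_distrib_left sum_distrib_right) (simp add: algebra_simps)
  finally have If: "(\<integral>\<phi>. f \<phi> \<partial>M) = of_nat (?N * ?N)" by (simp add: WW)
  define h where "h \<phi> = real ?N - (cmod (hs_inner W (E \<phi>)))\<^sup>2 / ?N" for \<phi>
  have hf: "h \<phi> = ?N - Re (f \<phi>) / ?N" for \<phi> by (simp add: h_def f_def)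
  have hint: "integrable M h"
    unfolding hf using fint by simp
  have "(\<integral>\<phi>. h \<phi> \<partial>M) = 0"
    unfolding hf using fint If by (simp add: prob_space)
  moreover have hn: "AE \<phi> in M. h \<phi> = (norm (E \<phi> - cscale (hs_inner W (E \<phi>) / of_nat ?N) W))\<^sup>2"
    using nrm by eventually_elim
      (simp add: h_def norm_hs_inner_defect WW normalized_op_def hs_inner_def[symmetric])
  moreover have "AE \<phi> in M. 0 \<le> h \<phi>" using hn by eventually_elim simp
  ultimately have "AE \<phi> in M. h \<phi> = 0"
    using integral_nonneg_eq_0_iff_AE[OF hint] by simp
  with hn nrm show ?thesis
  proof eventually_elim
    case (elim \<phi>)
    define c where "c = hs_inner W (E \<phi>) / of_nat ?N"
    have c: "E \<phi> = cscale c W" using elim by (simp add: c_def)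
    have "(cmod (hs_inner W (E \<phi>)))\<^sup>2 = (real ?N)\<^sup>2"
      using elim(3) by (simp add: h_def field_simps power2_eq_square)
    then have "cmod (hs_inner W (E \<phi>)) = real ?N" by (simp add: power2_eq_iff_nonneg)
    then have "cmod c = 1" by (simp add: c_def norm_divide)
    with c show ?case by blast
  qed
qed

lemma unit_scale_conjugation:
  assumes "cmod c = 1"
  shows "dagger (cscale c W) ** A ** cscale c W = dagger W ** A ** W"
proof -
  have cc: "cnj c * c = 1" using assms complex_norm_square[of c] by (simp add: mult.commute)
  have "dagger (cscale c W) ** A ** cscale c W = cscale (cnj c * c) (dagger W ** A ** W)"
    by (simp add: vec_eq_iff matrix_matrix_mult_def sum_distrib_left sum_distrib_right mult.assoc mult.left_commute)
  then show ?thesis by (simp add: cc)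
qed

lemma unitary_ensemble_adjoint:
  fixes E :: "'p \<Rightarrow> complex^'k^'k"
  assumes "prob_space M"
    and E: "\<And>\<rho>. integrable M (\<lambda>\<phi>. E \<phi> ** \<rho> ** dagger (E \<phi>))"
    and u: "unitary_channel (ensemble_map M E)"
    and nrm: "AE \<phi> in M. normalized_op (E \<phi>)"
  shows "AE \<phi> in M. \<forall>A. dagger (E \<phi>) ** A ** E \<phi> = hs_adjoint (ensemble_map M E) A"
proof -
  obtain W where W: "dagger W ** W = mat 1" "\<And>\<rho>. ensemble_map M E \<rho> = W ** \<rho> ** dagger W"
    using u by (auto simp: unitary_channel_def)
  have adj: "hs_adjoint (ensemble_map M E) = (\<lambda>A. dagger W ** A ** W)"
    by (rule hs_adjoint_unique) (simp add: W hs_inner_conjugation)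
  show ?thesis
    using unitary_ensemble_proportional[OF assms(1) E W nrm]
    by eventually_elim (auto simp: adj unit_scale_conjugation)
qed

text \<open>The adjoint of a trace preserving map fixes the identity, so evaluating there makes
  \<open>W\<close> an isometry, and a square isometry is unitary. The form of
  \<open>\<Lambda>\<close> follows because the adjoint determines the map.\<close>

lemma unitary_channel_if_adjoint_conjugation:
  assumes chan: "quantum_channel \<Lambda>" and W: "\<And>A. dagger W ** A ** W = hs_adjoint \<Lambda> A"
  shows "dagger W ** W = mat 1" and "unitary_channel \<Lambda>"
proof -
  have lin: "Vector_Spaces.linear cscale cscale \<Lambda>" and tr: "\<And>A. trace (\<Lambda> A) = trace A"
    using chan by (auto simp: quantum_channel_def)
  show WW: "dagger W ** W = mat 1"
    using W[of "mat 1"] hs_adjoint_trace_preserving_unital[OF lin tr] by simp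
  have "\<Lambda> \<rho> = W ** \<rho> ** dagger W" for \<rho>
  proof -
    have "hs_inner A (\<Lambda> \<rho>) = hs_inner A (W ** \<rho> ** dagger W)" for A
      using hs_adjoint_works[OF lin, of A \<rho>] hs_inner_conjugation[of W A \<rho>] by (simp add: W)
    then show ?thesis by (intro hs_inner_ext) (metis hs_inner_cnj)
  qed
  then show "unitary_channel \<Lambda>"
    using WW unfolding unitary_channel_def by (metis matrix_left_right_inverse)
qed

text \<open>Integrability is given for second moments of \<open>E\<close>, whereas the entries of
  its transfer matrices are of fourth order and may have infinite mean: hence the nonnegative
  integral. These entries are real and nonnegative, so \<open>Re\<close> and \<open>ennreal\<close>
  lose nothing.\<close>

theorem mainTheorem5:
  fixes g :: "'n::finite \<Rightarrow> 'm::finite"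
    and M :: "'p measure"
    and E :: "'p \<Rightarrow> 'n qop"
  assumes "surj g"
    and "prob_space M"
    and "E \<in> borel_measurable M"
    and "\<And>\<rho>. integrable M (\<lambda>\<phi>. E \<phi> ** \<rho> ** dagger (E \<phi>))"
    and "quantum_channel (ensemble_map M E)"
  shows "(\<forall>\<kappa> \<mu>. (\<integral>\<^sup>+\<phi>. ennreal (Re (transfer_matrix g (\<lambda>A. dagger (E \<phi>) ** A ** E \<phi>) \<kappa> \<mu>)) \<partial>M)
            \<ge> ennreal (Re (transfer_matrix g (hs_adjoint (ensemble_map M E)) \<kappa> \<mu>)))
    \<and> ((\<forall>\<kappa> \<mu>. (\<integral>\<^sup>+\<phi>. ennreal (Re (transfer_matrix g (\<lambda>A. dagger (E \<phi>) ** A ** E \<phi>) \<kappa> \<mu>)) \<partial>M)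
            = ennreal (Re (transfer_matrix g (hs_adjoint (ensemble_map M E)) \<kappa> \<mu>)))
        \<longleftrightarrow> unitary_channel (ensemble_map M E) \<and> (AE \<phi> in M. normalized_op (E \<phi>)))"
proof -
  interpret prob_space M by fact
  note int = assms(4)
  define L where "L = hs_adjoint (ensemble_map M E)"
  have lin: "Vector_Spaces.linear cscale cscale (ensemble_map M E)"
    using assms(5) by (simp add: quantum_channel_def)
  have Lherm: "dagger (L A) = L A" if "dagger A = A" for A
    unfolding L_def using lin ensemble_map_dagger[OF int] that by (rule hs_adjoint_hermitian)
  define X where "X = (\<lambda>(B, C) \<phi>. (dagger (E \<phi>) ** B ** E \<phi>) \<bullet> C)"
  \<comment> \<open>With the conjugation moved to the second argument, \<open>X p\<close> is a
    linear functional of an integrable operator; this gives its integrability and its mean.\<close>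
  have X: "X p = (\<lambda>\<phi>. fst p \<bullet> (E \<phi> ** snd p ** dagger (E \<phi>)))" for p
    by (simp add: X_def case_prod_beta inner_conjugation)
  have Xint: "integrable M (X p)" for p
    unfolding X by (intro integrable_inner_right int)
  have Xmean: "(\<integral>\<phi>. X p \<phi> \<partial>M) = L (fst p) \<bullet> snd p" for p
  proof -
    have "L (fst p) \<bullet> snd p = fst p \<bullet> ensemble_map M E (snd p)"
      by (metis L_def Re_hs_inner hs_adjoint_works[OF lin])
    then show ?thesis using int by (simp add: X ensemble_map_def)
  qed
  define w where "w \<mu> = 1 / real (qop.dim (locality_space g \<mu>))" for \<mu>
  define I where "I \<kappa> \<mu> = locality_basis g \<mu> \<times> locality_basis g \<kappa>" for \<kappa> \<mu>
  have fin: "finite (I \<kappa> \<mu>)" for \<kappa> \<mu>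
    by (simp add: I_def hermitian_onb_finite[OF locality_basis_onb])
  have w0: "0 \<le> w \<mu>" for \<mu> by (simp add: w_def)
  have TE: "Re (transfer_matrix g (\<lambda>A. dagger (E \<phi>) ** A ** E \<phi>) \<kappa> \<mu>) = w \<mu> * (\<Sum>p\<in>I \<kappa> \<mu>. (X p \<phi>)\<^sup>2)"
    for \<phi> \<kappa> \<mu>
    by (subst Re_transfer_matrix) (simp_all add: dagger_conjugation w_def I_def X_def case_prod_beta)
  have TL: "Re (transfer_matrix g L \<kappa> \<mu>) = w \<mu> * (\<Sum>p\<in>I \<kappa> \<mu>. (\<integral>\<phi>. X p \<phi> \<partial>M)\<^sup>2)" for \<kappa> \<mu>
    by (subst Re_transfer_matrix) (simp_all add: Lherm w_def I_def Xmean case_prod_beta)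
  note jensen = nn_integral_sum_squares[OF prob_space_axioms fin Xint w0]
  have unitary: "unitary_channel (ensemble_map M E) \<and> (AE \<phi> in M. normalized_op (E \<phi>))"
    if eq: "\<And>\<kappa> \<mu>. (\<integral>\<^sup>+\<phi>. ennreal (w \<mu> * (\<Sum>p\<in>I \<kappa> \<mu>. (X p \<phi>)\<^sup>2)) \<partial>M)
      = ennreal (w \<mu> * (\<Sum>p\<in>I \<kappa> \<mu>. (\<integral>\<phi>. X p \<phi> \<partial>M)\<^sup>2))"
  proof -
    have "AE \<phi> in M. X p \<phi> = L (fst p) \<bullet> snd p" if p: "p \<in> I \<kappa> \<mu>" for p \<kappa> \<mu>
    proof -
      have "0 < w \<mu>" using p dim_locality_space_pos[of "fst p" g \<mu>] by (auto simp: w_def I_def)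
      then show ?thesis using jensen(2)[OF eq _ p] by (simp add: Xmean)
    qed
    \<comment> \<open>Finitely many labels and basis elements: one null set serves them all.\<close>
    then have "AE \<phi> in M. \<forall>\<kappa> \<mu>. \<forall>p\<in>I \<kappa> \<mu>. X p \<phi> = L (fst p) \<bullet> snd p"
      by (simp add: AE_finite_all[OF fin] AE_all_countable)
    then have conj: "AE \<phi> in M. \<forall>A. dagger (E \<phi>) ** A ** E \<phi> = L A"
    proof eventually_elim
      case (elim \<phi>)
      interpret F: Vector_Spaces.linear cscale cscale "\<lambda>A. dagger (E \<phi>) ** A ** E \<phi>"
        by (rule linear_conjugation)
      interpret L: Vector_Spaces.linear cscale cscale L
        unfolding L_def by (rule linear_hs_adjoint[OF lin])
      \<comment> \<open>Both sides are Hermitian, so their real inner products with basis elements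
        \<open>C\<close> are the complex ones, and the \<open>C\<close> span all operators.
        Linearity in \<open>B\<close> then reaches every operator.\<close>
      have basis: "dagger (E \<phi>) ** B ** E \<phi> = L B" if B: "B \<in> locality_basis g \<mu>" for B \<mu>
      proof (rule hs_inner_ext, rule hs_inner_eq_on_span)
        fix C assume "C \<in> (\<Union>\<kappa>. locality_basis g \<kappa>)"
        then obtain \<kappa> where C: "C \<in> locality_basis g \<kappa>" by blast
        have "dagger B = B" "dagger C = C"
          using B C locality_basis_onb[of g] by (auto simp: hermitian_onb_def)
        moreover have "(dagger (E \<phi>) ** B ** E \<phi>) \<bullet> C = L B \<bullet> C"
          using elim B C by (force simp: I_def X_def)
        ultimately show "hs_inner (dagger (E \<phi>) ** B ** E \<phi>) C = hs_inner (L B) C"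
          by (simp add: hs_inner_hermitian dagger_conjugation Lherm)
      qed (simp add: span_locality_bases)
      show ?case
      proof
        fix A
        have "A \<in> qop.span (\<Union>\<kappa>. locality_basis g \<kappa>)" by (simp add: span_locality_bases)
        then show "dagger (E \<phi>) ** A ** E \<phi> = L A"
          by (induction rule: qop.span_induct_alt)
             (auto simp: F.zero F.add F.scale L.zero L.add L.scale basis)
      qed
    qed
    have chan: "dagger (E \<phi>) ** E \<phi> = mat 1" "unitary_channel (ensemble_map M E)"
      if "\<forall>A. dagger (E \<phi>) ** A ** E \<phi> = L A" for \<phi>
      using unitary_channel_if_adjoint_conjugation[OF assms(5), of "E \<phi>"] that by (auto simp: L_def)
    have "AE \<phi> in M. normalized_op (E \<phi>)"
      using conj by eventually_elim (simp add: normalized_op_def chan trace_I)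
    \<comment> \<open>Unitarity of the mean channel does not involve \<open>\<phi>\<close>; on a
      probability space an almost sure statement without \<open>\<phi>\<close> simply holds.\<close>
    moreover have "AE \<phi> in M. unitary_channel (ensemble_map M E)"
      using conj by eventually_elim (rule chan)
    ultimately show ?thesis by simp
  qed
  have "(\<integral>\<^sup>+\<phi>. ennreal (Re (transfer_matrix g (\<lambda>A. dagger (E \<phi>) ** A ** E \<phi>) \<kappa> \<mu>)) \<partial>M)
      = ennreal (Re (transfer_matrix g L \<kappa> \<mu>))"
    if "unitary_channel (ensemble_map M E)" "AE \<phi> in M. normalized_op (E \<phi>)" for \<kappa> \<mu>
  proof -
    have "AE \<phi> in M. (\<lambda>A. dagger (E \<phi>) ** A ** E \<phi>) = L"
      using unitary_ensemble_adjoint[OF prob_space_axioms int that]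
      by eventually_elim (simp add: fun_eq_iff L_def)
    then have "(\<integral>\<^sup>+\<phi>. ennreal (Re (transfer_matrix g (\<lambda>A. dagger (E \<phi>) ** A ** E \<phi>) \<kappa> \<mu>)) \<partial>M)
      = (\<integral>\<^sup>+\<phi>. ennreal (Re (transfer_matrix g L \<kappa> \<mu>)) \<partial>M)"
      by (intro nn_integral_cong_AE) (auto elim!: eventually_mono)
    then show ?thesis by (simp add: emeasure_space_1)
  qed
  then show ?thesis
    using jensen(1) unitary unfolding L_def[symmetric] by (auto simp: TE TL)
qed

end
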